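(* Consider the Bernoulli Design on $N$ units, under arbitrary interference. (1) If the estimand is of additive form $\theta(\mathbf{A},\mathbf{B})=\theta_1(\mathbf{A})+\theta_2(\mathbf{B})$, where $\theta_1(\mathbf{A})=g_1(\mathbf{Y}(\mathbf{A}))$ and $\theta_2(\mathbf{B})=g_2(\mathbf{Y}(\mathbf{B}))$ for real-valued functions $g_1,g_2$, then every unbiased estimator of $\theta(\mathbf{A},\mathbf{B})$ is of the form $$\hat\theta(\mathbf{Z}) = C(\mathbf{Z}) + 2^N\, I(\mathbf{Z}=\mathbf{A})\,\theta_1(\mathbf{A}) + 2^N\, I(\mathbf{Z}=\mathbf{B})\,\theta_2(\mathbf{B}),$$ where $C(\mathbf{Z})$ does not depend on any potential outcomes (it is a function of $\mathbf{Z}$ only) and satisfies $\sum_{\mathbf{Z}\in\mathcal{Z}} C(\mathbf{Z})=0$. (2) If the estimand $\theta(\mathbf{A},\mathbf{B})=g(\mathbf{Y}(\mathbf{A}),\mathbf{Y}(\mathbf{B}))$ is not of this additive form, then there exists no unbiased estimator of $\theta(\mathbf{A},\mathbf{B})$.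
   Context: There are $N$ units, each assigned to treatment $A$ or $B$. The assignment vector $\mathbf{Z}$ takes values in $\mathcal{Z}=\{A,B\}^N$; $\mathbf{A}=(A,\dots,A)$ and $\mathbf{B}=(B,\dots,B)$ are the assignments giving all units $A$, respectively all units $B$. For each $\mathbf{Z}\in\mathcal{Z}$ there is a fixed (non-random) vector of potential outcomes $\mathbf{Y}(\mathbf{Z})=(Y_1(\mathbf{Z}),\dots,Y_N(\mathbf{Z}))$. Potential outcomes are bounded: for a fixed constant $M>0$ (not depending on $N$), $0<Y_i(\mathbf{Z})<M$ for all $i$ and $\mathbf{Z}$. Arbitrary interference means that there is no other restriction: the family $\{\mathbf{Y}(\mathbf{Z})\}_{\mathbf{Z}\in\mathcal{Z}}$ may be any family of vectors in $(0,M)^N$, with no constraint relating $\mathbf{Y}(\mathbf{Z})$ and $\mathbf{Y}(\mathbf{Z}')$ for $\mathbf{Z}\neq\mathbf{Z}'$. An assignment mechanism (design) $\mathcal{R}$ is a probability distribution on $\mathcal{Z}$; it is the only source of randomness, and $\mathbb{E}_{\mathcal{R}}$ denotes expectation with respect to it. The Bernoulli Design assigns each unit independently to $A$ or $B$ with probability $1/2$ each, i.e. it is the uniform distribution on $\mathcal{Z}$. An estimand is a quantity $\theta(\mathbf{A},\mathbf{B})=g(\mathbf{Y}(\mathbf{A}),\mathbf{Y}(\mathbf{B}))$ with $g$ real-valued. An estimator $\hat\theta(\mathbf{Z})$ is a real-valued function of the observed data, i.e. of the realized assignment $\mathbf{Z}$ and the observed outcome vector $\mathbf{Y}(\mathbf{Z})$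 only. The estimator is unbiased if $\mathbb{E}_{\mathcal{R}}[\hat\theta(\mathbf{Z})]=\theta(\mathbf{A},\mathbf{B})$ for all values of the potential outcomes $\{\mathbf{Y}(\mathbf{Z})\}_{\mathbf{Z}\in\mathcal{Z}}$. $I(\cdot)$ is the indicator function. *)

theory Defs
  imports "HOL-Analysis.Finite_Cartesian_Product" "HOL-Probability.Product_PMF"
begin

datatype treatment = TrtA | TrtB

lemma UNIV_treatment: "UNIV = {TrtA, TrtB}"
  by (auto intro: treatment.exhaust)

instance treatment :: finite
  by standard (simp add: UNIV_treatment)

text \<open>
  The units are the elements of a finite index type \<open>'n\<close>, so the number of units is
  \<open>CARD('n)\<close>, which is at least 1.
\<close>

type_synonym 'n assignment = "'n \<Rightarrow> treatment"

definition all_A :: "'n assignment" where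
  "all_A = (\<lambda>_. TrtA)"

definition all_B :: "'n assignment" where
  "all_B = (\<lambda>_. TrtB)"

definition outcome_vectors :: "real \<Rightarrow> (real ^ 'n) set" where
  "outcome_vectors M = {y. \<forall>i. 0 < y $ i \<and> y $ i < M}"

text \<open>
  Arbitrary interference: \<open>Y Z\<close> and \<open>Y Z'\<close> are unrelated for distinct \<open>Z\<close> and \<open>Z'\<close>.
\<close>

definition potential_outcomes :: "real \<Rightarrow> ('n assignment \<Rightarrow> real ^ 'n) set" where
  "potential_outcomes M = {Y. \<forall>Z. Y Z \<in> outcome_vectors M}"

text \<open>
  The default value \<open>TrtA\<close> is only used outside the index set, hence never.
\<close>

definition bernoulli_design :: "'n::finite assignment pmf" where
  "bernoulli_design = Pi_pmf UNIV TrtA (\<lambda>_. pmf_of_set {TrtA, TrtB})"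

lemma bernoulli_design_uniform:
  "(bernoulli_design :: 'n::finite assignment pmf) = pmf_of_set UNIV"
proof -
  have "PiE_dflt (UNIV :: 'n set) TrtA (\<lambda>_. {TrtA, TrtB}) = UNIV"
    by (auto simp: PiE_dflt_def intro: treatment.exhaust)
  then show ?thesis
    unfolding bernoulli_design_def by (subst Pi_pmf_of_set) simp_all
qed

text \<open>
  An estimator is a function of the realized assignment and the observed outcome vector
  only; its realized value is \<open>est Z (Y Z)\<close>. The estimand is \<open>g (Y all_A) (Y all_B)\<close>.
  Only the values of \<open>est\<close> and \<open>g\<close> on admissible outcome vectors matter.
\<close>

definition unbiased ::
  "real \<Rightarrow> 'n::finite assignment pmf \<Rightarrow> ('n assignment \<Rightarrow> real ^ 'n \<Rightarrow> real)
    \<Rightarrow> (real ^ 'n \<Rightarrow> real ^ 'n \<Rightarrow> real) \<Rightarrow> bool" where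
  "unbiased M R est g \<longleftrightarrow>
    (\<forall>Y \<in> potential_outcomes M.
      measure_pmf.expectation R (\<lambda>Z. est Z (Y Z)) = g (Y all_A) (Y all_B))"

definition additive_form ::
  "real \<Rightarrow> (real ^ 'n \<Rightarrow> real ^ 'n \<Rightarrow> real)
    \<Rightarrow> (real ^ 'n \<Rightarrow> real) \<Rightarrow> (real ^ 'n \<Rightarrow> real) \<Rightarrow> bool" where
  "additive_form M g g1 g2 \<longleftrightarrow>
    (\<forall>a \<in> outcome_vectors M. \<forall>b \<in> outcome_vectors M. g a b = g1 a + g2 b)"

end

theory Submission
  imports Defs
begin

text \<open>
  Changing the outcome vector at a single assignment \<open>W\<close> changes the expectation of the estimator
  by \<open>2\<^sup>-\<^sup>N\<close> times the increment of \<open>est W\<close>. Hence \<open>est W\<close> is constant for \<open>W\<close> other than \<open>all_A\<close>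
  and \<open>all_B\<close>, while the increments of \<open>est all_A\<close> and \<open>est all_B\<close> are \<open>2\<^sup>N\<close> times the partial
  increments of \<open>g\<close> in its two arguments. Since \<open>est all_A\<close> does not see the second argument,
  this forces \<open>g\<close> to be additive.
\<close>

text \<open>The index type is inhabited, so there is a unit on which the two assignments differ;
  with no units they would coincide.\<close>

lemma all_A_neq_all_B: "all_A \<noteq> all_B"
  by (simp add: all_A_def all_B_def fun_eq_iff)

lemma card_assignment: "CARD('n::finite assignment) = 2 ^ CARD('n)"
  by (simp add: card_fun UNIV_treatment numeral_2_eq_2)

lemma potential_outcomes_update:
  assumes "Y \<in> potential_outcomes M" "y \<in> outcome_vectors M"
  shows "Y(W := y) \<in> potential_outcomes M"
  using assms by (simp add: potential_outcomes_def)

lemma potential_outcomes_const: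
  "y \<in> outcome_vectors M \<Longrightarrow> (\<lambda>_. y) \<in> potential_outcomes M"
  by (simp add: potential_outcomes_def)

lemma outcome_vectors_nonempty:
  assumes "M > 0"
  obtains y :: "real ^ 'n" where "y \<in> outcome_vectors M"
proof
  show "(\<chi> i. M / 2) \<in> outcome_vectors M"
    using assms by (simp add: outcome_vectors_def)
qed

text \<open>The design is uniform on \<open>2 ^ CARD('n)\<close> points, so clearing the denominator
  turns unbiasedness into identities between finite sums that can be subtracted from each
  other.\<close>

lemma unbiased_bernoulli_sum:
  fixes est :: "'n::finite assignment \<Rightarrow> real ^ 'n \<Rightarrow> real"
  assumes "unbiased M bernoulli_design est g" "Y \<in> potential_outcomes M"
  shows "(\<Sum>Z\<in>UNIV. est Z (Y Z)) = 2 ^ CARD('n) * g (Y all_A) (Y all_B)"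
proof -
  have "(\<Sum>Z\<in>UNIV. est Z (Y Z)) / 2 ^ CARD('n) = g (Y all_A) (Y all_B)"
    using assms
    by (simp add: unbiased_def bernoulli_design_uniform integral_pmf_of_set card_assignment
        del: card_fun)
  then show ?thesis
    by (simp add: field_simps)
qed

lemma unbiased_bernoulli_increment:
  fixes est :: "'n::finite assignment \<Rightarrow> real ^ 'n \<Rightarrow> real"
  assumes unb: "unbiased M bernoulli_design est g"
    and Y: "Y \<in> potential_outcomes M" and y: "y \<in> outcome_vectors M"
  shows "est W y - est W (Y W) =
    2 ^ CARD('n) * (g ((Y(W := y)) all_A) ((Y(W := y)) all_B) - g (Y all_A) (Y all_B))"
proof -
  have "(\<Sum>Z\<in>UNIV. est Z ((Y(W := y)) Z)) - (\<Sum>Z\<in>UNIV. est Z (Y Z)) = est W y - est W (Y W)"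
    by (simp add: sum.remove[of UNIV W])
  then show ?thesis
    using unbiased_bernoulli_sum[OF unb Y]
      unbiased_bernoulli_sum[OF unb potential_outcomes_update[OF Y y, of W]]
    by (simp add: right_diff_distrib)
qed

lemma unbiased_bernoulli_form:
  fixes est :: "'n::finite assignment \<Rightarrow> real ^ 'n \<Rightarrow> real"
  assumes "M > 0" and add: "additive_form M g g1 g2"
    and unb: "unbiased M bernoulli_design est g"
  shows "\<exists>C. (\<Sum>Z\<in>UNIV. C Z) = 0 \<and>
    (\<forall>Y \<in> potential_outcomes M. \<forall>Z.
      est Z (Y Z) = C Z
        + 2 ^ CARD('n) * of_bool (Z = all_A) * g1 (Y all_A)
        + 2 ^ CARD('n) * of_bool (Z = all_B) * g2 (Y all_B))"
proof -
  obtain y0 :: "real ^ 'n" where y0: "y0 \<in> outcome_vectors M"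
    using outcome_vectors_nonempty[OF \<open>M > 0\<close>] .
  let ?K = "2 ^ CARD('n) :: real"
  \<comment> \<open>\<open>C\<close> is what the claimed formula leaves over when every outcome
    vector is the fixed reference \<open>y0\<close>, so no potential outcome enters it.\<close>
  define C where "C Z = est Z y0 - ?K * of_bool (Z = all_A) * g1 y0
    - ?K * of_bool (Z = all_B) * g2 y0" for Z
  have g: "g a b = g1 a + g2 b" if "a \<in> outcome_vectors M" "b \<in> outcome_vectors M" for a b
    using add that by (simp add: additive_form_def)
  have "(\<Sum>Z\<in>UNIV. C Z) = (\<Sum>Z\<in>UNIV. est Z y0) - ?K * g1 y0 - ?K * g2 y0"
    by (simp add: C_def sum_subtractf flip: sum_distrib_left sum_distrib_right)
  also have "\<dots> = 0"
    using unbiased_bernoulli_sum[OF unb potential_outcomes_const[OF y0]]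
    by (simp add: g y0 distrib_left)
  finally have "(\<Sum>Z\<in>UNIV. C Z) = 0" .
  moreover have "est Z (Y Z) = C Z + ?K * of_bool (Z = all_A) * g1 (Y all_A)
      + ?K * of_bool (Z = all_B) * g2 (Y all_B)" if Y: "Y \<in> potential_outcomes M" for Y Z
  proof -
    have YZ: "Y W \<in> outcome_vectors M" for W
      using Y by (simp add: potential_outcomes_def)
    \<comment> \<open>Since \<open>est Z\<close> sees only \<open>Y Z\<close>, it suffices to change
      the constant family \<open>y0\<close> at \<open>Z\<close> alone. For \<open>Z = all_A\<close>
      the \<open>g2\<close> terms cancel, for \<open>Z = all_B\<close> the \<open>g1\<close> terms
      do, and for any other \<open>Z\<close> the increment is 0.\<close>
    show ?thesis
      using unbiased_bernoulli_increment[OF unb potential_outcomes_const[OF y0] YZ[of Z], of Z]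
        all_A_neq_all_B
      by (cases "Z = all_A"; cases "Z = all_B") (auto simp: C_def g y0 YZ algebra_simps)
  qed
  ultimately show ?thesis
    by blast
qed

text \<open>The summands are the slices of \<open>g\<close> through \<open>y0\<close>; subtracting
  \<open>g y0 y0\<close> keeps the base value from being counted twice. The contrapositive excludes
  unbiased estimators of a non-additive estimand.\<close>

lemma unbiased_bernoulli_imp_additive:
  fixes est :: "'n::finite assignment \<Rightarrow> real ^ 'n \<Rightarrow> real"
  assumes unb: "unbiased M bernoulli_design est g" and y0: "y0 \<in> outcome_vectors M"
  shows "additive_form M g (\<lambda>a. g a y0) (\<lambda>b. g y0 b - g y0 y0)"
proof -
  have "g a b = g a y0 + (g y0 b - g y0 y0)"
    if a: "a \<in> outcome_vectors M" and b: "b \<in> outcome_vectors M" for a b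
  proof -
    \<comment> \<open>Here \<open>c\<close> is the outcome vector at \<open>all_B\<close>. It is
      absent from the left side, so the increment of \<open>g\<close> in its first argument is the
      same for \<open>c = b\<close> and \<open>c = y0\<close>.\<close>
    have "est all_A a - est all_A y0 = 2 ^ CARD('n) * (g a c - g y0 c)"
      if "c \<in> outcome_vectors M" for c
      using unbiased_bernoulli_increment[OF unb
          potential_outcomes_update[OF potential_outcomes_const[OF y0] that] a,
          where W1 = all_B and W = all_A]
      by (simp add: all_A_neq_all_B all_A_neq_all_B[symmetric])
    from this[OF b] this[OF y0] have "g a b - g y0 b = g a y0 - g y0 y0"
      by simp
    then show ?thesis
      by simp
  qed
  then show ?thesis
    by (simp add: additive_form_def)
qed

theorem proposition1:
  fixes M :: real and g :: "real ^ 'n \<Rightarrow> real ^ 'n \<Rightarrow> real"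
  assumes "M > 0"
  shows
    "(\<forall>g1 g2. additive_form M g g1 g2 \<longrightarrow>
        (\<forall>est. unbiased M bernoulli_design est g \<longrightarrow>
          (\<exists>C :: 'n assignment \<Rightarrow> real.
            (\<Sum>Z\<in>UNIV. C Z) = 0 \<and>
            (\<forall>Y \<in> potential_outcomes M. \<forall>Z.
              est Z (Y Z) = C Z
                + 2 ^ CARD('n) * of_bool (Z = all_A) * g1 (Y all_A)
                + 2 ^ CARD('n) * of_bool (Z = all_B) * g2 (Y all_B)))))
     \<and> ((\<nexists>g1 g2. additive_form M g g1 g2) \<longrightarrow>
        (\<nexists>est. unbiased M bernoulli_design est g))"
proof (intro conjI allI impI)
  fix g1 g2 and est :: "'n assignment \<Rightarrow> real ^ 'n \<Rightarrow> real"
  assume "additive_form M g g1 g2" "unbiased M bernoulli_design est g"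
  then show "\<exists>C :: 'n assignment \<Rightarrow> real.
    (\<Sum>Z\<in>UNIV. C Z) = 0 \<and>
    (\<forall>Y \<in> potential_outcomes M. \<forall>Z.
      est Z (Y Z) = C Z
        + 2 ^ CARD('n) * of_bool (Z = all_A) * g1 (Y all_A)
        + 2 ^ CARD('n) * of_bool (Z = all_B) * g2 (Y all_B))"
    by (rule unbiased_bernoulli_form[OF assms])
next
  assume "\<nexists>g1 g2. additive_form M g g1 g2"
  moreover obtain y0 :: "real ^ 'n" where "y0 \<in> outcome_vectors M"
    using outcome_vectors_nonempty[OF assms] .
  ultimately show "\<nexists>est. unbiased M bernoulli_design est g"
    using unbiased_bernoulli_imp_additive by blast
qed

end
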